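(* Consider an ODMTS design $\mathbf z^1$, and assume that the optimal route for trip $r$ under $\mathbf z^1$ includes the shuttle trips from origin $or^r$ to hub $m$ and from hub $n$ to destination $de^r$, with a trip time $t^1$. For any design $\mathbf z^2$ such that $\mathbf z^1\ge\mathbf z^2$, the time $t^2$ of the optimal route for trip $r$ under $\mathbf z^2$ satisfies $$t^2\ge t^1+\frac{1-\theta}{\theta}\,g\left(d_{or^rm}+d_{nde^r}-\max\left\{\max_{h,l\in H}\{d_{or^rh}+d_{lde^r}\},\ d_{or^rde^r}\right\}\right).$$
   Context: $N$ is a finite set of nodes, $H\subseteq N$ the set of hubs. Trip $r$ has distinct origin $or^r$ and destination $de^r$ in $N\setminus H$. For $i,j\in N$, $t_{ij}\ge0$ and $d_{ij}\ge0$ are travel time and distance (possibly asymmetric), each satisfying the triangle inequality. $\theta\in(0,1]$, $g\ge0$ is the shuttle cost per mile, $s\ge0$ the average bus waiting time. Put $\gamma^r_{ij}=(1-\theta)g\,d_{ij}+\theta t_{ij}$ and $\tau^r_{hl}=\theta(t_{hl}+s)$. An ODMTS design is a $\mathbf z\in\{0,1\}^{|H|\times|H|}$ ($z_{hl}=1$ iff the bus leg from $h$ to $l$ is open); $\mathbf z^1\ge\mathbf z^2$ means $z^1_{hl}\ge z^2_{hl}$ for all $h,l\in H$. Given $\mathbf z$, the optimal route of $r$ is a solution of: lexicographically minimize $\langle b^r,f^r\rangle$ (first $b^r$, then $f^r$) over binary $x^r_{hl}$ ($h,l\in H$) and $y^r_{ij}$ ($(i,j)\in A^r$), with $b^r=\sum\tau^r_{hl}x^r_{hl}+\sum\gamma^r_{ij}y^r_{ij}$,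 $f^r=\sum(t_{hl}+s)x^r_{hl}+\sum t_{ij}y^r_{ij}$, subject to $x^r_{hl}\le z_{hl}$ and unit flow conservation from $or^r$ to $de^r$ over bus legs ($x$) and shuttle legs ($y$). Here $A^r=\{(or^r,h),(h,de^r):h\in H\}\cup\{(or^r,de^r)\}$ (other shuttle arcs are unnecessary by the triangle inequality). A route is either a direct shuttle ride from $or^r$ to $de^r$, or a shuttle from $or^r$ to a hub, bus leg(s) between hubs, and a shuttle from a hub to $de^r$. The (trip) time of the optimal route is the lexicographically optimal value of $f^r$ (unique for given $\mathbf z$). *)

theory Defs
  imports Complex_Main
begin

record 'v odmts =
  nodes :: "'v set"
  hubs :: "'v set"
  travel_time :: "'v \<Rightarrow> 'v \<Rightarrow> real"
  distance :: "'v \<Rightarrow> 'v \<Rightarrow> real"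
  theta :: real
  shuttle_cost :: real
  waiting_time :: real

record 'v trip =
  origin :: 'v
  destination :: 'v

definition triangle_on :: "'v set \<Rightarrow> ('v \<Rightarrow> 'v \<Rightarrow> real) \<Rightarrow> bool" where
  "triangle_on N f \<longleftrightarrow> (\<forall>i\<in>N. \<forall>j\<in>N. \<forall>k\<in>N. f i k \<le> f i j + f j k)"

definition valid_odmts :: "'v odmts \<Rightarrow> bool" where
  "valid_odmts P \<longleftrightarrow>
     finite (nodes P) \<and> hubs P \<subseteq> nodes P \<and>
     (\<forall>i\<in>nodes P. \<forall>j\<in>nodes P. 0 \<le> travel_time P i j \<and> 0 \<le> distance P i j) \<and>
     triangle_on (nodes P) (travel_time P) \<and> triangle_on (nodes P) (distance P) \<and>
     0 < theta P \<and> theta P \<le> 1 \<and> 0 \<le> shuttle_cost P \<and> 0 \<le> waiting_time P"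

definition valid_trip :: "'v odmts \<Rightarrow> 'v trip \<Rightarrow> bool" where
  "valid_trip P r \<longleftrightarrow>
     origin r \<in> nodes P - hubs P \<and> destination r \<in> nodes P - hubs P \<and>
     origin r \<noteq> destination r"

(* A design, like the route variables below, is a real-valued function of which
   only the values on the relevant index set matter. *)

definition design :: "'v odmts \<Rightarrow> ('v \<Rightarrow> 'v \<Rightarrow> real) \<Rightarrow> bool" where
  "design P z \<longleftrightarrow> (\<forall>h\<in>hubs P. \<forall>l\<in>hubs P. z h l \<in> {0, 1})"

definition design_ge :: "'v odmts \<Rightarrow> ('v \<Rightarrow> 'v \<Rightarrow> real) \<Rightarrow> ('v \<Rightarrow> 'v \<Rightarrow> real) \<Rightarrow> bool" where
  "design_ge P z1 z2 \<longleftrightarrow> (\<forall>h\<in>hubs P. \<forall>l\<in>hubs P. z2 h l \<le> z1 h l)"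

definition shuttle_arcs :: "'v odmts \<Rightarrow> 'v trip \<Rightarrow> ('v \<times> 'v) set" where
  "shuttle_arcs P r =
     {(origin r, h) |h. h \<in> hubs P} \<union> {(h, destination r) |h. h \<in> hubs P} \<union>
     {(origin r, destination r)}"

definition shuttle_weight :: "'v odmts \<Rightarrow> 'v \<Rightarrow> 'v \<Rightarrow> real" where
  "shuttle_weight P i j =
     (1 - theta P) * shuttle_cost P * distance P i j + theta P * travel_time P i j"

definition bus_weight :: "'v odmts \<Rightarrow> 'v \<Rightarrow> 'v \<Rightarrow> real" where
  "bus_weight P h l = theta P * (travel_time P h l + waiting_time P)"

definition route_cost ::
  "'v odmts \<Rightarrow> 'v trip \<Rightarrow> ('v \<Rightarrow> 'v \<Rightarrow> real) \<Rightarrow> ('v \<Rightarrow> 'v \<Rightarrow> real) \<Rightarrow> real" where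
  "route_cost P r x y =
     (\<Sum>h\<in>hubs P. \<Sum>l\<in>hubs P. bus_weight P h l * x h l) +
     (\<Sum>(i, j)\<in>shuttle_arcs P r. shuttle_weight P i j * y i j)"

definition route_time ::
  "'v odmts \<Rightarrow> 'v trip \<Rightarrow> ('v \<Rightarrow> 'v \<Rightarrow> real) \<Rightarrow> ('v \<Rightarrow> 'v \<Rightarrow> real) \<Rightarrow> real" where
  "route_time P r x y =
     (\<Sum>h\<in>hubs P. \<Sum>l\<in>hubs P. (travel_time P h l + waiting_time P) * x h l) +
     (\<Sum>(i, j)\<in>shuttle_arcs P r. travel_time P i j * y i j)"

definition net_outflow ::
  "'v odmts \<Rightarrow> 'v trip \<Rightarrow> ('v \<Rightarrow> 'v \<Rightarrow> real) \<Rightarrow> ('v \<Rightarrow> 'v \<Rightarrow> real) \<Rightarrow> 'v \<Rightarrow> real" where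
  "net_outflow P r x y i =
     (if i \<in> hubs P then (\<Sum>h\<in>hubs P. x i h) - (\<Sum>h\<in>hubs P. x h i) else 0) +
     (\<Sum>j | (i, j) \<in> shuttle_arcs P r. y i j) - (\<Sum>j | (j, i) \<in> shuttle_arcs P r. y j i)"

definition feasible_route ::
  "'v odmts \<Rightarrow> 'v trip \<Rightarrow> ('v \<Rightarrow> 'v \<Rightarrow> real) \<Rightarrow> ('v \<Rightarrow> 'v \<Rightarrow> real) \<Rightarrow> ('v \<Rightarrow> 'v \<Rightarrow> real) \<Rightarrow> bool" where
  "feasible_route P r z x y \<longleftrightarrow>
     (\<forall>h\<in>hubs P. \<forall>l\<in>hubs P. x h l \<in> {0, 1} \<and> x h l \<le> z h l) \<and>
     (\<forall>(i, j)\<in>shuttle_arcs P r. y i j \<in> {0, 1}) \<and>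
     (\<forall>i\<in>nodes P. net_outflow P r x y i =
        (if i = origin r then 1 else if i = destination r then -1 else 0))"

definition optimal_route ::
  "'v odmts \<Rightarrow> 'v trip \<Rightarrow> ('v \<Rightarrow> 'v \<Rightarrow> real) \<Rightarrow> ('v \<Rightarrow> 'v \<Rightarrow> real) \<Rightarrow> ('v \<Rightarrow> 'v \<Rightarrow> real) \<Rightarrow> bool" where
  "optimal_route P r z x y \<longleftrightarrow>
     feasible_route P r z x y \<and>
     (\<forall>x' y'. feasible_route P r z x' y' \<longrightarrow>
        route_cost P r x y < route_cost P r x' y' \<or>
        route_cost P r x y = route_cost P r x' y' \<and> route_time P r x y \<le> route_time P r x' y')"

(* For a design z all optimal routes have the same time, and one exists because the
   direct shuttle ride is feasible and only finitely many binary values matter;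
   hence the description is proper. *)

definition trip_time :: "'v odmts \<Rightarrow> 'v trip \<Rightarrow> ('v \<Rightarrow> 'v \<Rightarrow> real) \<Rightarrow> real" where
  "trip_time P r z = (THE t. \<exists>x y. optimal_route P r z x y \<and> t = route_time P r x y)"

end

theory Submission
  imports Defs
begin

text \<open>
  The cost of a route is \<open>\<theta>\<close> times its time plus \<open>(1 - \<theta>) g\<close> times its shuttle distance. A route that
  is feasible for the smaller design is feasible for the larger one, so the optimal cost can only
  increase from \<open>z1\<close> to \<open>z2\<close>. The shuttle distance of the first route is at least
  \<open>d(or, m) + d(n, de)\<close>, and flow conservation at the origin and the destination leaves the second
  route either the direct shuttle leg or exactly one leg into and one leg out of the hubs.
\<close>

section \<open>Cost decomposition, binary sums and lexicographic minima\<close>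

definition shuttle_distance :: "'v odmts \<Rightarrow> 'v trip \<Rightarrow> ('v \<Rightarrow> 'v \<Rightarrow> real) \<Rightarrow> real" where
  "shuttle_distance P r y = (\<Sum>(i, j)\<in>shuttle_arcs P r. distance P i j * y i j)"

lemma route_cost_eq:
  "route_cost P r x y =
     theta P * route_time P r x y + (1 - theta P) * shuttle_cost P * shuttle_distance P r y"
  by (simp add: route_cost_def route_time_def shuttle_distance_def bus_weight_def
      shuttle_weight_def sum_distrib_left sum.distrib sum_subtractf case_prod_unfold algebra_simps)

lemma feasible_route_mono:
  assumes "design_ge P z1 z2" "feasible_route P r z2 x y"
  shows "feasible_route P r z1 x y"
  using assms unfolding feasible_route_def design_ge_def by (meson order_trans)

text \<open>Routes are total functions with arbitrary values off the index sets. Cost and time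
  ignore those values, so a route may be replaced there by any convenient representative.\<close>

lemma route_values_cong:
  assumes "\<And>h l. h \<in> hubs P \<Longrightarrow> l \<in> hubs P \<Longrightarrow> x h l = x' h l"
    and "\<And>i j. (i, j) \<in> shuttle_arcs P r \<Longrightarrow> y i j = y' i j"
  shows "(route_cost P r x y, route_time P r x y) = (route_cost P r x' y', route_time P r x' y')"
  unfolding route_cost_def route_time_def
  by (intro arg_cong2[where f = Pair] arg_cong2[where f = "(+)"] sum.cong refl)
    (auto simp: assms)

text \<open>Turns unit flow at an end of the trip into the choice of a single shuttle leg: once one
  term equals 1, the remaining nonnegative terms sum to 0.\<close>

lemma sum_binary_eq_1E:
  fixes f :: "'a \<Rightarrow> real"
  assumes "finite A" "\<forall>a\<in>A. f a \<in> {0, 1}" "sum f A = 1"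
  obtains a where "a \<in> A" "\<forall>b\<in>A. f b = (if b = a then 1 else 0)"
proof -
  have "\<exists>a\<in>A. f a \<noteq> 0"
    using assms(3) sum.neutral by force
  then obtain a where a: "a \<in> A" "f a = 1"
    using assms(2) by auto
  then have "sum f (A - {a}) = 0"
    using assms by (simp add: sum_diff1)
  moreover have "\<forall>b\<in>A - {a}. 0 \<le> f b"
    using assms(2) by fastforce
  ultimately have "\<forall>b\<in>A - {a}. f b = 0"
    using assms(1) sum_nonneg_eq_0_iff[of "A - {a}" f] by blast
  with a show thesis
    by (intro that[of a]) auto
qed

lemma finite_lexicographic_minimum:
  fixes V :: "('a::linorder \<times> 'b::linorder) set"
  assumes "finite V" "V \<noteq> {}"
  obtains p where "p \<in> V" "\<forall>q\<in>V. fst p < fst q \<or> fst p = fst q \<and> snd p \<le> snd q"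
proof -
  \<comment> \<open>Minimize in two stages: \<open>b\<close> is the least first component, and among
    the pairs in \<open>W\<close> that attain it the second component is minimized.\<close>
  define b where "b = Min (fst ` V)"
  define W where "W = {q \<in> V. fst q = b}"
  have "b \<in> fst ` V"
    using assms by (simp add: b_def)
  then have W: "finite W" "W \<noteq> {}"
    using assms by (auto simp: W_def)
  then have "Min (snd ` W) \<in> snd ` W"
    by simp
  then obtain p where p: "p \<in> W" "snd p = Min (snd ` W)"
    by force
  have "fst p < fst q \<or> fst p = fst q \<and> snd p \<le> snd q" if "q \<in> V" for q
  proof -
    have "b \<le> fst q"
      using assms that by (simp add: b_def)
    moreover have "snd p \<le> snd q" if "fst q = b"
      using W(1) p(2) \<open>q \<in> V\<close> that by (simp add: W_def)
    ultimately show ?thesis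
      using p(1) by (auto simp: W_def)
  qed
  with p show thesis
    by (intro that[of p]) (auto simp: W_def)
qed

text \<open>Each route is a feasible competitor of the other, so the costs tie and the times bound
  each other. This makes the description in \<open>trip_time\<close> proper.\<close>

lemma optimal_route_time_unique:
  assumes "optimal_route P r z x y" "optimal_route P r z x' y'"
  shows "route_time P r x y = route_time P r x' y'"
  using assms unfolding optimal_route_def by (smt (verit))

lemma trip_time_eq:
  assumes "optimal_route P r z x y"
  shows "trip_time P r z = route_time P r x y"
  unfolding trip_time_def
  using assms optimal_route_time_unique by (intro the_equality) blast+

section \<open>Shuttle arcs and flow at the two ends of the trip\<close>

context
  fixes P :: "'v odmts" and r :: "'v trip"
  assumes valid_odmts: "valid_odmts P" and valid_trip: "valid_trip P r"
begin

lemma finite_hubs: "finite (hubs P)"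
  using valid_odmts finite_subset unfolding valid_odmts_def by blast

lemma origin_destination:
  "origin r \<in> nodes P" "destination r \<in> nodes P" "origin r \<notin> hubs P" "destination r \<notin> hubs P"
  "origin r \<noteq> destination r"
  using valid_trip by (auto simp: valid_trip_def)

lemma finite_shuttle_arcs: "finite (shuttle_arcs P r)"
  using finite_hubs by (simp add: shuttle_arcs_def)

text \<open>The three families of arcs are disjoint because neither end of the trip is a
  hub.\<close>

lemma sum_shuttle_arcs:
  "(\<Sum>(i, j)\<in>shuttle_arcs P r. f i j) =
     (\<Sum>h\<in>hubs P. f (origin r) h) + (\<Sum>h\<in>hubs P. f h (destination r)) +
     f (origin r) (destination r)" for f :: "'v \<Rightarrow> 'v \<Rightarrow> real"
proof -
  let ?A = "Pair (origin r) ` hubs P" and ?B = "(\<lambda>h. (h, destination r)) ` hubs P"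
  have "shuttle_arcs P r = ?A \<union> ?B \<union> {(origin r, destination r)}"
    by (auto simp: shuttle_arcs_def)
  moreover have "?A \<inter> ?B = {}" "(?A \<union> ?B) \<inter> {(origin r, destination r)} = {}"
    using origin_destination by auto
  ultimately show ?thesis
    using finite_hubs by (simp add: sum.union_disjoint sum.reindex inj_on_def)
qed

text \<open>Every shuttle arc ends in a hub or at the destination, so none enters the origin; bus
  legs contribute nothing at a node that is not a hub.\<close>

lemma net_outflow_origin:
  "net_outflow P r x y (origin r) = (\<Sum>j\<in>insert (destination r) (hubs P). y (origin r) j)"
proof -
  have "{j. (origin r, j) \<in> shuttle_arcs P r} = insert (destination r) (hubs P)"
    "{j. (j, origin r) \<in> shuttle_arcs P r} = {}"
    using origin_destination by (auto simp: shuttle_arcs_def)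
  then show ?thesis
    using origin_destination by (simp add: net_outflow_def)
qed

lemma net_outflow_destination:
  "net_outflow P r x y (destination r) = - (\<Sum>i\<in>insert (origin r) (hubs P). y i (destination r))"
proof -
  have "{j. (destination r, j) \<in> shuttle_arcs P r} = {}"
    "{j. (j, destination r) \<in> shuttle_arcs P r} = insert (origin r) (hubs P)"
    using origin_destination by (auto simp: shuttle_arcs_def)
  then show ?thesis
    using origin_destination by (simp add: net_outflow_def)
qed

section \<open>Existence of an optimal route\<close>

lemma feasible_direct_route:
  assumes "design P z"
  shows "feasible_route P r z (\<lambda>_ _. 0)
    (\<lambda>i j. if i = origin r \<and> j = destination r then 1 else 0)"
    (is "feasible_route P r z ?x ?y")
proof -
  have "net_outflow P r ?x ?y i = 0" if "i \<noteq> origin r" "i \<noteq> destination r" for i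
    using that by (simp add: net_outflow_def)
  moreover have "net_outflow P r ?x ?y (origin r) = 1"
    "net_outflow P r ?x ?y (destination r) = -1"
    using finite_hubs origin_destination
    by (auto simp: net_outflow_origin net_outflow_destination intro!: sum.neutral)
  ultimately show ?thesis
    using assms by (fastforce simp: feasible_route_def design_def)
qed

text \<open>There may be infinitely many feasible pairs of functions, but cost and time depend only
  on which bus legs and shuttle arcs carry the value 1. The indicator functions of these finitely
  many arc sets therefore already produce all values.\<close>

lemma finite_route_values:
  "finite {(route_cost P r x y, route_time P r x y) |x y. feasible_route P r z x y}"
proof -
  let ?ind = "\<lambda>S i j. of_bool ((i, j) \<in> S) :: real"
  let ?F = "\<lambda>(S, T). (route_cost P r (?ind S) (?ind T), route_time P r (?ind S) (?ind T))"
  let ?D = "Pow (hubs P \<times> hubs P) \<times> Pow (shuttle_arcs P r)"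
  have "(route_cost P r x y, route_time P r x y) \<in> ?F ` ?D" if "feasible_route P r z x y" for x y
  proof
    let ?S = "{(h, l) \<in> hubs P \<times> hubs P. x h l = 1}"
    let ?T = "{(i, j) \<in> shuttle_arcs P r. y i j = 1}"
    show "(?S, ?T) \<in> ?D"
      by auto
    have x: "x h l = ?ind ?S h l" if "h \<in> hubs P" "l \<in> hubs P" for h l
      using that \<open>feasible_route P r z x y\<close> by (auto simp: feasible_route_def)
    have y: "y i j = ?ind ?T i j" if "(i, j) \<in> shuttle_arcs P r" for i j
      using that \<open>feasible_route P r z x y\<close> by (auto simp: feasible_route_def)
    have "(route_cost P r x y, route_time P r x y) =
        (route_cost P r (?ind ?S) (?ind ?T), route_time P r (?ind ?S) (?ind ?T))"
      using x y by (rule route_values_cong)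
    then show "(route_cost P r x y, route_time P r x y) = ?F (?S, ?T)"
      by simp
  qed
  then have "{(route_cost P r x y, route_time P r x y) |x y. feasible_route P r z x y} \<subseteq> ?F ` ?D"
    by blast
  moreover have "finite ?D"
    using finite_hubs finite_shuttle_arcs by simp
  ultimately show ?thesis
    using finite_subset by blast
qed

lemma optimal_route_exists:
  assumes "design P z"
  obtains x y where "optimal_route P r z x y"
proof -
  let ?V = "{(route_cost P r x y, route_time P r x y) |x y. feasible_route P r z x y}"
  have "?V \<noteq> {}"
    using feasible_direct_route[OF assms] by blast
  with finite_route_values obtain p
    where p: "p \<in> ?V" "\<forall>q\<in>?V. fst p < fst q \<or> fst p = fst q \<and> snd p \<le> snd q"
    by (rule finite_lexicographic_minimum)
  then obtain x y where xy: "feasible_route P r z x y" "p = (route_cost P r x y, route_time P r x y)"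
    by blast
  have "optimal_route P r z x y"
    unfolding optimal_route_def
  proof (intro conjI allI impI)
    fix x' y'
    assume "feasible_route P r z x' y'"
    then have "(route_cost P r x' y', route_time P r x' y') \<in> ?V"
      by blast
    from p(2)[rule_format, OF this] show "route_cost P r x y < route_cost P r x' y' \<or>
        route_cost P r x y = route_cost P r x' y' \<and> route_time P r x y \<le> route_time P r x' y'"
      by (simp add: xy(2))
  qed (rule xy(1))
  then show thesis
    by (rule that)
qed

section \<open>Shuttle distance of feasible routes\<close>

lemma shuttle_distance_cases:
  assumes "feasible_route P r z x y"
  obtains "shuttle_distance P r y = distance P (origin r) (destination r)"
  | h l where "h \<in> hubs P" "l \<in> hubs P"
      "shuttle_distance P r y = distance P (origin r) h + distance P l (destination r)"
proof -
  let ?o = "origin r" and ?d = "destination r" and ?H = "hubs P"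
  \<comment> \<open>Conservation at the two ends suffices: every shuttle arc touches one of them,
    and bus legs, including possible cycles among hubs, do not enter the shuttle distance.\<close>
  have binary: "\<forall>(i, j)\<in>shuttle_arcs P r. y i j \<in> {0, 1}"
    and flow: "(\<Sum>j\<in>insert ?d ?H. y ?o j) = 1" "(\<Sum>i\<in>insert ?o ?H. y i ?d) = 1"
    using assms origin_destination net_outflow_origin[of x y] net_outflow_destination[of x y]
    by (auto simp: feasible_route_def)
  obtain j where j: "j \<in> insert ?d ?H" "\<forall>k\<in>insert ?d ?H. y ?o k = (if k = j then 1 else 0)"
    by (rule sum_binary_eq_1E[OF _ _ flow(1)])
      (use binary finite_hubs in \<open>auto simp: shuttle_arcs_def\<close>)
  obtain i where i: "i \<in> insert ?o ?H" "\<forall>k\<in>insert ?o ?H. y k ?d = (if k = i then 1 else 0)"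
    by (rule sum_binary_eq_1E[OF _ _ flow(2)])
      (use binary finite_hubs in \<open>auto simp: shuttle_arcs_def\<close>)
  \<comment> \<open>Both selections contain the direct arc, so its value \<open>y ?o ?d\<close>
    decides both sides.\<close>
  have direct_iff: "j = ?d \<longleftrightarrow> i = ?o"
    using i(2) j(2) by (metis insertI1 zero_neq_one)
  have "shuttle_distance P r y =
      (\<Sum>k\<in>?H. if k = j then distance P ?o k else 0) + (\<Sum>k\<in>?H. if k = i then distance P k ?d else 0) +
      distance P ?o ?d * y ?o ?d"
    unfolding shuttle_distance_def sum_shuttle_arcs
    using i(2) j(2) by (intro arg_cong2[where f = "(+)"] sum.cong refl) auto
  \<comment> \<open>Each hub sum collapses to its selected term, or to 0 if the selected leg is the
    direct one.\<close>
  then have D: "shuttle_distance P r y =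
      (if j \<in> ?H then distance P ?o j else 0) + (if i \<in> ?H then distance P i ?d else 0) +
      distance P ?o ?d * (if j = ?d then 1 else 0)"
    using finite_hubs j(2) by auto
  show thesis
  proof (cases "j = ?d")
    case True
    then show thesis
      using D direct_iff origin_destination that(1) by simp
  next
    case False
    then show thesis
      using D direct_iff i(1) j(1) that(2)[of j i] by simp
  qed
qed

lemma shuttle_distance_le:
  assumes "feasible_route P r z x y"
  shows "shuttle_distance P r y \<le>
    max (Max {distance P (origin r) h + distance P l (destination r) |h l.
                h \<in> hubs P \<and> l \<in> hubs P})
        (distance P (origin r) (destination r))" (is "_ \<le> max (Max ?M) _")
proof -
  have "?M = (\<lambda>(h, l). distance P (origin r) h + distance P l (destination r)) ` (hubs P \<times> hubs P)"
    by auto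
  then have "finite ?M"
    using finite_hubs by simp
  \<comment> \<open>Without hubs \<open>Max ?M\<close> is unspecified. The bound is applied only
    when the route supplies hubs \<open>h\<close> and \<open>l\<close>; a direct ride is covered by
    the other argument of \<open>max\<close>.\<close>
  then have bound: "distance P (origin r) h + distance P l (destination r) \<le> Max ?M"
    if "h \<in> hubs P" "l \<in> hubs P" for h l
    using that by (intro Max_ge) auto
  from assms show ?thesis
  proof (cases rule: shuttle_distance_cases)
    case 1
    then show ?thesis
      by simp
  next
    case (2 h l)
    then show ?thesis
      using bound[of h l] by simp
  qed
qed

lemma shuttle_distance_ge:
  assumes "feasible_route P r z x y" "m \<in> hubs P" "n \<in> hubs P"
    and "y (origin r) m = 1" "y n (destination r) = 1"
  shows "distance P (origin r) m + distance P n (destination r) \<le> shuttle_distance P r y"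
proof -
  let ?A = "{(origin r, m), (n, destination r)}"
  have "?A \<subseteq> shuttle_arcs P r"
    using assms by (auto simp: shuttle_arcs_def)
  moreover have "0 \<le> distance P i j * y i j" if "(i, j) \<in> shuttle_arcs P r" for i j
  proof -
    have "i \<in> nodes P" "j \<in> nodes P"
      using that origin_destination valid_odmts by (auto simp: shuttle_arcs_def valid_odmts_def)
    then have "0 \<le> distance P i j"
      using valid_odmts by (auto simp: valid_odmts_def)
    moreover have "y i j \<in> {0, 1}"
      using assms(1) that by (auto simp: feasible_route_def)
    ultimately show ?thesis
      by auto
  qed
  ultimately have "(\<Sum>(i, j)\<in>?A. distance P i j * y i j) \<le> shuttle_distance P r y"
    unfolding shuttle_distance_def using finite_shuttle_arcs by (intro sum_mono2) auto
  \<comment> \<open>If the two arcs coincided, the sum over \<open>?A\<close> would count only one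
    distance. They differ since \<open>n\<close> is a hub and the origin is not.\<close>
  moreover have "(origin r, m) \<noteq> (n, destination r)"
    using assms origin_destination by auto
  ultimately show ?thesis
    using assms by simp
qed

end

theorem proposition5:
  fixes P :: "'v odmts" and r :: "'v trip"
    and z1 z2 x1 y1 :: "'v \<Rightarrow> 'v \<Rightarrow> real" and m n :: 'v and t1 t2 :: real
  assumes "valid_odmts P" and "valid_trip P r"
    and "design P z1" and "design P z2" and "design_ge P z1 z2"
    and "m \<in> hubs P" and "n \<in> hubs P"
    and "optimal_route P r z1 x1 y1"
    and "y1 (origin r) m = 1" and "y1 n (destination r) = 1"
    and "t1 = trip_time P r z1" and "t2 = trip_time P r z2"
  shows "t2 \<ge> t1 + (1 - theta P) / theta P * shuttle_cost P *
    (distance P (origin r) m + distance P n (destination r) -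
      max (Max {distance P (origin r) h + distance P l (destination r) |h l.
                  h \<in> hubs P \<and> l \<in> hubs P})
          (distance P (origin r) (destination r)))"
    (is "_ \<ge> _ + _ * (?lower - ?upper)")
proof -
  \<comment> \<open>A concrete optimal route under \<open>z2\<close> is needed to evaluate the
    description behind \<open>t2\<close>.\<close>
  obtain x2 y2 where opt2: "optimal_route P r z2 x2 y2"
    using optimal_route_exists assms(1,2,4) by blast
  let ?D1 = "shuttle_distance P r y1" and ?D2 = "shuttle_distance P r y2"
    and ?c = "(1 - theta P) * shuttle_cost P"
  have theta: "0 < theta P" and c: "0 \<le> ?c"
    using assms(1) by (auto simp: valid_odmts_def)
  have feasible1: "feasible_route P r z1 x1 y1" and feasible2: "feasible_route P r z2 x2 y2"
    using assms(8) opt2 by (auto simp: optimal_route_def)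
  have t: "t1 = route_time P r x1 y1" "t2 = route_time P r x2 y2"
    using trip_time_eq assms(8,11,12) opt2 by blast+
  \<comment> \<open>The second route competes under \<open>z1\<close> as well. Both alternatives of
    lexicographic optimality give this cost inequality; the tie-break on time is not
    compared.\<close>
  have "route_cost P r x1 y1 \<le> route_cost P r x2 y2"
    using feasible_route_mono[OF assms(5) feasible2] assms(8)
    unfolding optimal_route_def by fastforce
  then have "theta P * t1 + ?c * (?D1 - ?D2) \<le> theta P * t2"
    by (simp add: route_cost_eq t algebra_simps)
  \<comment> \<open>Lower bound for the first route, upper bound for the second; multiplying by
    \<open>?c\<close> keeps the direction because \<open>theta P\<close> is at most 1 and the
    shuttle cost is nonnegative.\<close>
  moreover have "?lower - ?upper \<le> ?D1 - ?D2"
    using shuttle_distance_ge[OF assms(1,2) feasible1 assms(6,7,9,10)]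
      shuttle_distance_le[OF assms(1,2) feasible2] by linarith
  then have "?c * (?lower - ?upper) \<le> ?c * (?D1 - ?D2)"
    using c by (rule mult_left_mono)
  ultimately have "theta P * t1 + ?c * (?lower - ?upper) \<le> theta P * t2"
    by linarith
  then have "(theta P * t1 + ?c * (?lower - ?upper)) / theta P \<le> t2"
    using theta by (simp add: pos_divide_le_eq mult.commute)
  then show ?thesis
    using theta by (simp add: add_divide_distrib)
qed

end
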